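(* Let $d\ge 1$ be an integer and let $\Phi=\langle T,(\varphi_{ij}\mid i,j\in T)\rangle$ be a second order problem with $|T|\ge 2$. Run the algorithm SOLVE (defined in the context) on input $\Phi$, with arbitrary choices of the elements $t$ and of the (possibly non-unique) sets $\operatorname{arg}_{(d)}\min$ made during its execution. Then: 1. If the algorithm does not return the message "discard", then the set $\mathrm{Sol}'$ it returns satisfies $$\mathrm{Sol}'=\operatorname*{arg_{(d)}min}_{\bar x\in K^T}\ \max_{i,j\in T}\varphi_{ij}(x_i,x_j),$$ i.e. the algorithm returns a valid solution of the problem $\Phi$. 2. If the problem $\Phi$ has a majority polymorphism, then the same equality holds without any further condition, i.e. the algorithm does not return "discard" and the returned set $\mathrm{Sol}'$ satisfies $$\mathrm{Sol}'=\operatorname*{arg_{(d)}min}_{\bar x\in K^T}\ \max_{i,j\in T}\varphi_{ij}(x_i,x_j).$$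
   Context: $T$ and $K$ are finite nonempty sets (objects and labels) and $W$ is a totally ordered set with least element $\min W$. $K^S$ denotes the set of labellings $S\to K$ for $S\subset T$; $x_i$ is the value of a labelling at $i$. For $x\in K^S$ with $S=T\setminus\{t\}$ and $k\in K$, $(x,k)\in K^T$ is the labelling equal to $x$ on $S$ and with value $k$ at $t$. $\operatorname{arg}_{(d)}\min$: for a finite set $I$, a function $f:I\to W$ and an integer $d\ge1$, the expression $I^*=\operatorname{arg_{(d)}min}_{i\in I}f(i)$ means: if $d<|I|$, then $I^*\subset I$, $|I^*|=d$ and $f(i)\le f(j)$ for all $i\in I^*$, $j\in I\setminus I^*$; if $d\ge |I|$, then $I^*=I$. (Such a set need not be unique; the expression asserts that $I^*$ is one such set.) A second order problem $\Phi=\langle T,(\varphi_{ij}\mid i,j\in T)\rangle$ consists of functions $\varphi_{ij}:K\times K\to W$ with $\varphi_{ij}(k,k')=\varphi_{ji}(k',k)$ for all $i,j\in T$, $k,k'\in K$, and $\varphi_{ii}(k,k')=\min W$ for all $i\in T$, $k,k'\in K$. Its objective function is $\bar x\mapsto\max_{i,j\in T}\varphi_{ij}(x_i,x_j)$ on $K^T$. A collection $P=(p_i\mid i\in T)$ of operators $p_i:K\times K\times K\to K$ is a majority operator if $p_i(y,x,x)=p_i(x,y,x)=p_i(x,x,y)=x$ for all $i\in T$, $x,y\in K$. $P$ is a polymorphism of $\Phi$ if for all $i\ne j$ in $T$ and all $a_1,a_2,a_3,b_1,b_2,b_3\in K$: $\varphi_{ij}(p_i(a_1,a_2,a_3),p_j(b_1,b_2,b_3))\le\max_{r=1,2,3}\varphi_{ij}(a_r,b_r)$.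 "$\Phi$ has a majority polymorphism" means that some majority operator is a polymorphism of $\Phi$. Algorithm SOLVE (recursive; fixed $d$). Input: a second order problem $\Phi=\langle T,(\varphi_{ij})\rangle$, $|T|\ge2$. Output: a set of labellings or the message "discard". Step 0. If $T=\{a,b\}$ has two elements, return a set $\operatorname{arg_{(d)}min}_{(x_a,x_b)\in K^2}\varphi_{ab}(x_a,x_b)$. Otherwise continue. Step 1. Pick any $t\in T$ and let $S=T\setminus\{t\}$. Step 2. Construct the second order problem $\Omega=\langle T,(\omega_{ij}\mid i,j\in T)\rangle$ as follows. For $k\in K$ let $q(k)=\max_{i\in S}\min_{x\in K}\varphi_{ti}(k,x)$. For $i\neq j$ in $S$ and $x,y\in K$ let $\psi_{ij}(x,y)=\min_{k\in K}\max\{\varphi_{ti}(k,x),\varphi_{tj}(k,y),q(k)\}$ and $\omega_{ij}(x,y)=\max\{\varphi_{ij}(x,y),\psi_{ij}(x,y)\}$. For $i\in S$ let $\omega_{ti}(k,x)=\omega_{it}(x,k)=\varphi_{ti}(k,x)$. For all $i\in T$ let $\omega_{ii}\equiv\min W$. Step 3. Apply SOLVE recursively to $\Omega^*=\langle S,(\omega_{ij}\mid i,j\in S)\rangle$. If this call returns "discard", return "discard"; otherwise denote the returned set by $\mathrm{Sol}(\Omega^* )$. Step 4. If there is at least one $x\in\mathrm{Sol}(\Omega^* )$ with $\max_{i,j\in S}\omega_{ij}(x_i,x_j)<\min_{k\in K}\max_{i\in S}\omega_{ti}(k,x_i)$, return "discard". Step 5. Let $\mathrm{WORK}=\{(x,x_t)\in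 K^T\mid x\in\mathrm{Sol}(\Omega^* ),\ x_t\in K\}$. Step 6. Return a set $\mathrm{Sol}'=\operatorname{arg_{(d)}min}_{\bar x\in\mathrm{WORK}}\max_{i,j\in T}\omega_{ij}(x_i,x_j)$. *)

theory Defs
  imports Main "HOL-Library.FuncSet"
begin

text \<open>
  The fixed finite nonempty set of labels is a type of class \<open>finite\<close>, and the fixed totally
  ordered set with least element is a type of classes \<open>linorder\<close> and \<open>order_bot\<close>. The set of
  objects shrinks during the recursion, so it is an explicit set \<open>T\<close>. A family of functions
  indexed by pairs of objects is a total function of the two indices, of which only the values
  at indices in \<open>T\<close> matter.
\<close>

type_synonym ('a, 'k, 'w) family = "'a \<Rightarrow> 'a \<Rightarrow> 'k \<Rightarrow> 'k \<Rightarrow> 'w"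

definition labellings :: "'a set \<Rightarrow> ('a \<Rightarrow> 'k) set" where
  "labellings S = S \<rightarrow>\<^sub>E (UNIV :: 'k set)"

text \<open>
  The set of \<open>d\<close> best elements need not be unique, so this is a predicate on its last argument.
\<close>

definition is_arg_d_min :: "nat \<Rightarrow> ('i \<Rightarrow> 'w::linorder) \<Rightarrow> 'i set \<Rightarrow> 'i set \<Rightarrow> bool" where
  "is_arg_d_min d f I J \<longleftrightarrow>
     (if d < card I
      then J \<subseteq> I \<and> card J = d \<and> (\<forall>i\<in>J. \<forall>j\<in>I - J. f i \<le> f j)
      else J = I)"

definition second_order_problem ::
    "'a set \<Rightarrow> ('a, 'k, 'w::{linorder,order_bot}) family \<Rightarrow> bool" where
  "second_order_problem T \<phi> \<longleftrightarrow>
     (\<forall>i\<in>T. \<forall>j\<in>T. \<forall>k k'. \<phi> i j k k' = \<phi> j i k' k) \<and>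
     (\<forall>i\<in>T. \<forall>k k'. \<phi> i i k k' = bot)"

definition objective ::
    "'a set \<Rightarrow> ('a, 'k, 'w::linorder) family \<Rightarrow> ('a \<Rightarrow> 'k) \<Rightarrow> 'w" where
  "objective T \<phi> x = (MAX (i, j)\<in>T \<times> T. \<phi> i j (x i) (x j))"

definition majority_operator :: "'a set \<Rightarrow> ('a \<Rightarrow> 'k \<Rightarrow> 'k \<Rightarrow> 'k \<Rightarrow> 'k) \<Rightarrow> bool" where
  "majority_operator T p \<longleftrightarrow>
     (\<forall>i\<in>T. \<forall>x y. p i y x x = x \<and> p i x y x = x \<and> p i x x y = x)"

definition polymorphism ::
    "'a set \<Rightarrow> ('a, 'k, 'w::linorder) family \<Rightarrow> ('a \<Rightarrow> 'k \<Rightarrow> 'k \<Rightarrow> 'k \<Rightarrow> 'k) \<Rightarrow> bool" where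
  "polymorphism T \<phi> p \<longleftrightarrow>
     (\<forall>i\<in>T. \<forall>j\<in>T. i \<noteq> j \<longrightarrow> (\<forall>a1 a2 a3 b1 b2 b3.
        \<phi> i j (p i a1 a2 a3) (p j b1 b2 b3)
          \<le> max (\<phi> i j a1 b1) (max (\<phi> i j a2 b2) (\<phi> i j a3 b3))))"

definition has_majority_polymorphism ::
    "'a set \<Rightarrow> ('a, 'k, 'w::linorder) family \<Rightarrow> bool" where
  "has_majority_polymorphism T \<phi> \<longleftrightarrow> (\<exists>p. majority_operator T p \<and> polymorphism T \<phi> p)"


text \<open>
  The problem built in one elimination step; \<open>t\<close> is the eliminated object and \<open>S\<close> is the set
  of the remaining objects.
\<close>

definition qfun ::
    "'a set \<Rightarrow> 'a \<Rightarrow> ('a, 'k::finite, 'w::linorder) family \<Rightarrow> 'k \<Rightarrow> 'w" where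
  "qfun S t \<phi> k = (MAX i\<in>S. MIN x. \<phi> t i k x)"

definition psi ::
    "'a set \<Rightarrow> 'a \<Rightarrow> ('a, 'k::finite, 'w::linorder) family \<Rightarrow> ('a, 'k, 'w) family" where
  "psi S t \<phi> i j x y = (MIN k. max (\<phi> t i k x) (max (\<phi> t j k y) (qfun S t \<phi> k)))"

definition omega ::
    "'a set \<Rightarrow> 'a \<Rightarrow> ('a, 'k::finite, 'w::{linorder,order_bot}) family \<Rightarrow> ('a, 'k, 'w) family"
  where
  "omega S t \<phi> i j x y =
     (if i = j then bot
      else if i = t then \<phi> t j x y
      else if j = t then \<phi> t i y x
      else max (\<phi> i j x y) (psi S t \<phi> i j x y))"


text \<open>
  \<open>solve d T \<phi> r\<close> says that \<open>r\<close> is the outcome of some run of the algorithm on the problem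
  \<open>\<phi>\<close> with set of objects \<open>T\<close>; all choices made by the algorithm are left open.
\<close>

datatype ('a, 'k) outcome = Discard | Solution "('a \<Rightarrow> 'k) set"

inductive solve ::
    "nat \<Rightarrow> 'a set \<Rightarrow> ('a, 'k::finite, 'w::{linorder,order_bot}) family
      \<Rightarrow> ('a, 'k) outcome \<Rightarrow> bool"
  for d :: nat where
  two_objects:
    "\<lbrakk>T = {a, b}; a \<noteq> b;
      is_arg_d_min d (\<lambda>x. \<phi> a b (x a) (x b)) (labellings T) Sol\<rbrakk>
     \<Longrightarrow> solve d T \<phi> (Solution Sol)"
| discard_in_recursion:
    "\<lbrakk>2 < card T; t \<in> T; S = T - {t}; \<omega> = omega S t \<phi>;
      solve d S \<omega> Discard\<rbrakk>
     \<Longrightarrow> solve d T \<phi> Discard"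
| discard_by_test:
    "\<lbrakk>2 < card T; t \<in> T; S = T - {t}; \<omega> = omega S t \<phi>;
      solve d S \<omega> (Solution Sol);
      \<exists>x\<in>Sol. objective S \<omega> x < (MIN k. MAX i\<in>S. \<omega> t i k (x i))\<rbrakk>
     \<Longrightarrow> solve d T \<phi> Discard"
| extend:
    "\<lbrakk>2 < card T; t \<in> T; S = T - {t}; \<omega> = omega S t \<phi>;
      solve d S \<omega> (Solution Sol);
      \<not> (\<exists>x\<in>Sol. objective S \<omega> x < (MIN k. MAX i\<in>S. \<omega> t i k (x i)));
      WORK = {x(t := k) | x k. x \<in> Sol};
      is_arg_d_min d (objective T \<omega>) WORK Sol'\<rbrakk>
     \<Longrightarrow> solve d T \<phi> (Solution Sol')"


text \<open>
  Every problem with at least two objects has a run, so statements about all outcomes are not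
  vacuous.
\<close>

lemma is_arg_d_min_exists:
  fixes f :: "'i \<Rightarrow> 'w::linorder"
  assumes "finite I"
  shows "\<exists>J. is_arg_d_min d f I J"
proof (cases "d < card I")
  case True
  have "\<exists>J \<subseteq> I. card J = d \<and> (\<forall>i\<in>J. \<forall>j\<in>I - J. f i \<le> f j)" if "d \<le> card I" for d
    using that
  proof (induction d)
    case 0
    show ?case by (rule exI[of _ "{}"]) simp
  next
    case (Suc d)
    then obtain J where J: "J \<subseteq> I" "card J = d" "\<forall>i\<in>J. \<forall>j\<in>I - J. f i \<le> f j" by auto
    have fin: "finite (I - J)" "finite J" using assms J(1) finite_subset by auto
    have "I - J \<noteq> {}" using J Suc.prems by (metis Diff_eq_empty_iff Suc_n_not_le_n subset_antisym)
    then obtain m where m: "m \<in> I - J" "\<forall>j\<in>I - J. f m \<le> f j"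
      using arg_min_if_finite(1)[OF fin(1), of f] arg_min_least[OF fin(1), of _ f] by meson
    show ?case
      by (rule exI[of _ "insert m J"]) (use J m fin in auto)
  qed
  from this[of d] True show ?thesis by (auto simp: is_arg_d_min_def)
next
  case False
  then show ?thesis by (simp add: is_arg_d_min_def)
qed

lemma finite_labellings:
  "finite S \<Longrightarrow> finite (labellings S :: ('a \<Rightarrow> 'k::finite) set)"
  by (simp add: labellings_def finite_PiE)

lemma solve_solution_subset:
  assumes "solve d T \<phi> (Solution Sol)"
  shows "Sol \<subseteq> labellings T"
  using assms
proof (induction T \<phi> "Solution Sol" arbitrary: Sol rule: solve.induct)
  case (two_objects T a b \<phi> Sol)
  then show ?case by (auto simp: is_arg_d_min_def split: if_splits)
next
  case (extend T t S \<omega> \<phi> Sol WORK Sol')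
  have "Sol' \<subseteq> WORK" using extend.hyps by (auto simp: is_arg_d_min_def split: if_splits)
  moreover have "WORK \<subseteq> labellings T"
    using extend.hyps by (fastforce simp: labellings_def PiE_iff extensional_def)
  ultimately show ?case by simp
qed

lemma solve_exists:
  assumes "2 \<le> card T"
  shows "\<exists>r. solve d T \<phi> r"
  using assms
proof (induction "card T" arbitrary: T \<phi> rule: less_induct)
  case less
  have finT: "finite T" using less.prems by (intro card_ge_0_finite) simp
  show ?case
  proof (cases "card T = 2")
    case True
    then obtain a b where "T = {a, b}" "a \<noteq> b" by (auto simp: card_2_iff)
    then show ?thesis
      using is_arg_d_min_exists[OF finite_labellings[OF finT], of d "\<lambda>x. \<phi> a b (x a) (x b)"]
        solve.two_objects[of T a b d \<phi>] by blast
  next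
    case False
    then have big: "2 < card T" using less.prems by simp
    then obtain t where t: "t \<in> T" by fastforce
    define S where "S = T - {t}"
    define \<omega> where "\<omega> = omega S t \<phi>"
    have "card S < card T" "2 \<le> card S" using big t finT by (auto simp: S_def)
    then obtain r where r: "solve d S \<omega> r" using less.hyps by blast
    show ?thesis
    proof (cases r)
      case Discard
      then show ?thesis using solve.discard_in_recursion[OF big t S_def \<omega>_def] r by blast
    next
      case (Solution Sol)
      note r = r[unfolded Solution]
      have "finite Sol"
        using solve_solution_subset[OF r] finite_labellings finT
        by (metis S_def finite_Diff finite_subset)
      moreover have "{x(t := k) | x k. x \<in> Sol} = (\<lambda>(x, k). x(t := k)) ` (Sol \<times> UNIV)" by auto
      ultimately have "finite {x(t := k) | x k. x \<in> Sol}" by simp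
      then obtain Sol' where
        "is_arg_d_min d (objective T \<omega>) {x(t := k) | x k. x \<in> Sol} Sol'"
        using is_arg_d_min_exists by blast
      then show ?thesis
        using solve.discard_by_test[OF big t S_def \<omega>_def r]
          solve.extend[OF big t S_def \<omega>_def r _ refl] by blast
    qed
  qed
qed

end

theory Submission
  imports Defs
begin

text \<open>
  The objective function of \<open>\<Omega>\<close> coincides with that of \<open>\<Phi>\<close>, and it dominates that of \<open>\<Omega>\<^sup>*\<close>.
  Passing the test of Step 4 means that every labelling in \<open>Sol(\<Omega>\<^sup>*)\<close> extends to \<open>T\<close> without
  increasing its value, so the \<open>d\<close> best labellings can be sought among the extensions of
  \<open>Sol(\<Omega>\<^sup>*)\<close>. A majority polymorphism of \<open>\<Phi>\<close> is inherited by \<open>\<Omega>\<^sup>*\<close>, and a Helly-type argument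
  in the style of Baker and Pixley shows that then every labelling of \<open>S\<close> extends to \<open>T\<close> without
  increasing its value: \<open>\<psi>\<close> yields labels compatible with two objects at a time, the majority
  operator merges them, and the bound on \<open>q\<close> supplies the third argument of \<open>p\<^sub>i\<close>.
\<close>

section \<open>Objective functions and thresholds\<close>

lemma objective_le_iff:
  assumes "finite T" "T \<noteq> {}"
  shows "objective T \<phi> x \<le> v \<longleftrightarrow> (\<forall>i\<in>T. \<forall>j\<in>T. \<phi> i j (x i) (x j) \<le> v)"
  using assms by (auto simp: objective_def)

lemma le_objective:
  assumes "finite T" "i \<in> T" "j \<in> T"
  shows "\<phi> i j (x i) (x j) \<le> objective T \<phi> x"
  using objective_le_iff[of T \<phi> x "objective T \<phi> x"] assms by auto

lemma objective_cong:
  assumes "\<And>i. i \<in> T \<Longrightarrow> x i = y i"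
  shows "objective T \<phi> x = objective T \<phi> y"
  unfolding objective_def using assms by (auto intro!: arg_cong[of _ _ Max] image_cong)

lemma second_order_problem_sym:
  assumes "second_order_problem T \<phi>" "i \<in> T" "j \<in> T"
  shows "\<phi> i j k k' = \<phi> j i k' k"
  using assms unfolding second_order_problem_def by blast

lemma second_order_problem_diag:
  assumes "second_order_problem T \<phi>" "i \<in> T"
  shows "\<phi> i i k k' = bot"
  using assms unfolding second_order_problem_def by blast

text \<open>The base case of the algorithm minimises only \<open>\<phi> a b\<close>. This is the
  full objective because the diagonal terms are \<open>bot\<close> and the two off-diagonal ones
  agree by symmetry.\<close>

lemma objective_two_objects:
  fixes \<phi> :: "('a, 'k, 'w::{linorder,order_bot}) family"
  assumes "second_order_problem {a, b} \<phi>"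
  shows "objective {a, b} \<phi> x = \<phi> a b (x a) (x b)"
proof (rule antisym)
  have "\<phi> b a (x b) (x a) = \<phi> a b (x a) (x b)"
    by (rule second_order_problem_sym[OF assms]) simp_all
  then show "objective {a, b} \<phi> x \<le> \<phi> a b (x a) (x b)"
    by (subst objective_le_iff) (auto simp: second_order_problem_diag[OF assms])
qed (rule le_objective; simp)

section \<open>Selecting the \<open>d\<close> best elements through a projection\<close>

text \<open>Abstract form of one recursion level: \<open>B\<close> stands for the labellings of
  \<open>T\<close>, \<open>\<pi>\<close> for restriction to \<open>S\<close>, and \<open>F\<close>,
  \<open>G\<close> for the two objectives. If \<open>Sol\<close> is a choice of \<open>d\<close>
  elements, each has a preimage of no larger value, so the filtered set holds \<open>d\<close>
  elements that nothing outside it beats; otherwise the filter keeps all of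
  \<open>B\<close>.\<close>

lemma is_arg_d_min_extension:
  fixes F :: "'b \<Rightarrow> 'w::linorder" and G :: "'a \<Rightarrow> 'w"
  assumes finB: "finite B"
    and Sol: "is_arg_d_min d G (\<pi> ` B) Sol"
    and lower: "\<And>b. b \<in> B \<Longrightarrow> G (\<pi> b) \<le> F b"
    and attained: "\<And>x. x \<in> Sol \<Longrightarrow> \<exists>b\<in>B. \<pi> b = x \<and> F b \<le> G x"
    and Sol': "is_arg_d_min d F {b \<in> B. \<pi> b \<in> Sol} Sol'"
  shows "is_arg_d_min d F B Sol'"
proof (cases "d < card (\<pi> ` B)")
  case False
  then have "Sol = \<pi> ` B" using Sol by (simp add: is_arg_d_min_def)
  then have "{b \<in> B. \<pi> b \<in> Sol} = B" by auto
  then show ?thesis using Sol' by simp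
next
  case True
  let ?W = "{b \<in> B. \<pi> b \<in> Sol}"
  have S: "Sol \<subseteq> \<pi> ` B" "card Sol = d" "\<And>x y. x \<in> Sol \<Longrightarrow> y \<in> \<pi> ` B - Sol \<Longrightarrow> G x \<le> G y"
    using Sol True by (auto simp: is_arg_d_min_def)
  have big: "d < card B" using True card_image_le[OF finB, of \<pi>] by linarith
  obtain g where g: "\<And>x. x \<in> Sol \<Longrightarrow> g x \<in> B \<and> \<pi> (g x) = x \<and> F (g x) \<le> G x"
    using attained by metis
  have "inj_on g Sol" by (rule inj_on_inverseI[of _ \<pi>]) (use g in auto)
  then have card_g: "card (g ` Sol) = d" using S(2) by (simp add: card_image)
  have g_sub: "g ` Sol \<subseteq> ?W" using g by auto
  have finW: "finite ?W" using finB by simp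
  have "d \<le> card ?W" using card_mono[OF finW g_sub] card_g by simp
  \<comment> \<open>In the boundary case \<open>card ?W = d\<close> the definition gives
    \<open>Sol' = ?W\<close>, which also has \<open>d\<close> elements and leaves nothing to
    compare.\<close>
  then have S': "Sol' \<subseteq> ?W" "card Sol' = d" "\<And>i j. i \<in> Sol' \<Longrightarrow> j \<in> ?W - Sol' \<Longrightarrow> F i \<le> F j"
    using Sol' by (auto simp: is_arg_d_min_def split: if_splits)
  have "F i \<le> F j" if i: "i \<in> Sol'" and j: "j \<in> B - Sol'" for i j
  proof (cases "\<pi> j \<in> Sol")
    case True
    then show ?thesis using S'(3)[OF i] j by auto
  next
    case False
    have above: "F (g x) \<le> F j" if "x \<in> Sol" for x
    proof -
      have "F (g x) \<le> G x" using g that by blast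
      also have "\<dots> \<le> G (\<pi> j)" using S(3) that False j by blast
      also have "\<dots> \<le> F j" using lower j by blast
      finally show ?thesis .
    qed
    \<comment> \<open>Either \<open>Sol'\<close> contains all \<open>d\<close> chosen preimages and
      equals their set by cardinality, or it omits some \<open>g x\<close>, which then separates the
      value of \<open>i\<close> from that of \<open>j\<close>.\<close>
    show ?thesis
    proof (cases "g ` Sol \<subseteq> Sol'")
      case True
      have "finite Sol'" using S'(1) finW finite_subset by blast
      then have "g ` Sol = Sol'" using True card_g S'(2) by (intro card_subset_eq) auto
      then show ?thesis using above i by auto
    next
      case False
      then obtain x where x: "x \<in> Sol" "g x \<notin> Sol'" by auto
      then have "F i \<le> F (g x)" using S'(3)[OF i] g_sub by blast
      then show ?thesis using above[OF x(1)] by (rule order_trans)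
    qed
  qed
  then show ?thesis using S' big by (auto simp: is_arg_d_min_def)
qed

section \<open>The problem after eliminating one object\<close>

text \<open>At a fixed threshold \<open>v\<close> the nested maxima and minima become quantifiers.
  Later arguments treat "value at most \<open>v\<close>" as a crisp constraint and never compute the
  minima.\<close>

lemma qfun_le_iff:
  fixes \<phi> :: "('a, 'k::finite, 'w::linorder) family"
  assumes "finite S" "S \<noteq> {}"
  shows "qfun S t \<phi> k \<le> v \<longleftrightarrow> (\<forall>i\<in>S. \<exists>x. \<phi> t i k x \<le> v)"
  using assms by (auto simp: qfun_def Min_le_iff)

lemma psi_le_iff:
  fixes \<phi> :: "('a, 'k::finite, 'w::linorder) family"
  shows "psi S t \<phi> i j x y \<le> v \<longleftrightarrow>
    (\<exists>k. \<phi> t i k x \<le> v \<and> \<phi> t j k y \<le> v \<and> qfun S t \<phi> k \<le> v)"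
  by (auto simp: psi_def Min_le_iff)

lemma psi_commute: "psi S t \<phi> i j x y = psi S t \<phi> j i y x"
  by (simp add: psi_def max.left_commute)

lemma second_order_problem_omega:
  assumes "second_order_problem T \<phi>" "S \<subseteq> T - {t}"
  shows "second_order_problem S (omega S t \<phi>)"
proof -
  have "omega S t \<phi> i j k k' = omega S t \<phi> j i k' k" if "i \<in> S" "j \<in> S" for i j k k'
  proof -
    have "\<phi> i j k k' = \<phi> j i k' k"
      using that assms(2) by (intro second_order_problem_sym[OF assms(1)]) auto
    then show ?thesis using psi_commute[of S t \<phi> i j k k'] by (simp add: omega_def)
  qed
  then show ?thesis unfolding second_order_problem_def by (simp add: omega_def)
qed

text \<open>The added terms never exceed the objective: \<open>x t\<close> is a witness for the
  minimum in \<open>psi\<close>, and each \<open>x i\<close> is one for the inner minimum in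
  \<open>qfun\<close> at \<open>x t\<close>. Conversely, every \<open>\<phi>\<close> term survives
  in \<open>omega\<close>, possibly with its indices swapped.\<close>

lemma objective_omega:
  fixes \<phi> :: "('a, 'k::finite, 'w::{linorder,order_bot}) family"
  assumes prob: "second_order_problem T \<phi>" and fin: "finite T" and t: "t \<in> T"
    and S: "S = T - {t}" "S \<noteq> {}"
  shows "objective T (omega S t \<phi>) x = objective T \<phi> x"
proof -
  note sym = second_order_problem_sym[OF prob] and diag = second_order_problem_diag[OF prob]
  have finS: "finite S" using fin S by simp
  let ?v = "objective T \<phi> x"
  have le: "\<phi> i j (x i) (x j) \<le> ?v" if "i \<in> T" "j \<in> T" for i j
    using le_objective[OF fin that] .
  have q: "qfun S t \<phi> (x t) \<le> ?v"
    using le[OF t] S by (subst qfun_le_iff[OF finS S(2)]) blast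
  have psi: "psi S t \<phi> i j (x i) (x j) \<le> ?v" if "i \<in> T" "j \<in> T" for i j
    using q le t that by (subst psi_le_iff) blast
  show ?thesis
  proof (rule antisym)
    show "objective T (omega S t \<phi>) x \<le> ?v"
      using fin t le psi by (subst objective_le_iff) (auto simp: omega_def)
    have "\<phi> i j (x i) (x j) \<le> omega S t \<phi> i j (x i) (x j)" if "i \<in> T" "j \<in> T" for i j
      using sym[OF that] by (auto simp: omega_def diag that)
    then show "?v \<le> objective T (omega S t \<phi>) x"
      using le_objective[OF fin, of _ _ "omega S t \<phi>" x] t
      by (subst objective_le_iff[OF fin]) (blast intro: order_trans)+
  qed
qed

section \<open>Restriction and extension of labellings\<close>

lemma labellings_iff: "x \<in> labellings S \<longleftrightarrow> (\<forall>i. i \<notin> S \<longrightarrow> x i = undefined)"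
  by (auto simp: labellings_def PiE_iff extensional_def)

lemma labellings_undefined:
  assumes "x \<in> labellings S" "t \<notin> S"
  shows "x(t := undefined) = x"
  using assms by (auto simp: labellings_iff)

lemma fun_upd_in_labellings:
  assumes "x \<in> labellings (T - {t})" "t \<in> T"
  shows "x(t := k) \<in> labellings T"
  using assms by (auto simp: labellings_iff)

text \<open>Labellings are \<open>undefined\<close> outside their domain, so resetting the value at
  \<open>t\<close> is restriction. This presents the labellings of \<open>S\<close> as an image, as
  \<open>is_arg_d_min_extension\<close> requires.\<close>

lemma labellings_remove:
  fixes T :: "'a set"
  assumes "t \<in> T"
  shows "(\<lambda>z. z(t := undefined)) ` labellings T = (labellings (T - {t}) :: ('a \<Rightarrow> 'k) set)"
    (is "?L = ?R")
proof
  show "?L \<subseteq> ?R"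
    by (auto simp: labellings_iff)
  show "?R \<subseteq> ?L"
  proof
    fix x assume x: "x \<in> ?R"
    show "x \<in> ?L"
    proof
      show "x = (x(t := k))(t := undefined)" for k using labellings_undefined[OF x] by simp
      show "x(t := k) \<in> labellings T" for k by (rule fun_upd_in_labellings[OF x assms])
    qed
  qed
qed

text \<open>Rewrites the set \<open>WORK\<close> of the algorithm as the preimage of
  \<open>Sol\<close> under restriction, the form used in
  \<open>is_arg_d_min_extension\<close>.\<close>

lemma extensions_eq:
  assumes "t \<in> T" "Sol \<subseteq> labellings (T - {t})"
  shows "{x(t := k) | x k. x \<in> Sol} = {z \<in> labellings T. z(t := undefined) \<in> Sol}"
proof (intro equalityI subsetI)
  fix z assume "z \<in> {x(t := k) | x k. x \<in> Sol}"
  then obtain x k where z: "z = x(t := k)" and x: "x \<in> Sol" by auto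
  have "x \<in> labellings (T - {t})" using x assms by auto
  then have "x(t := undefined) = x" "z \<in> labellings T"
    using assms(1) z labellings_undefined fun_upd_in_labellings by fastforce+
  then show "z \<in> {z \<in> labellings T. z(t := undefined) \<in> Sol}" using x z by simp
next
  fix z assume "z \<in> {z \<in> labellings T. z(t := undefined) \<in> Sol}"
  moreover have "z = (z(t := undefined))(t := z t)" by simp
  ultimately show "z \<in> {x(t := k) | x k. x \<in> Sol}" by blast
qed

section \<open>Correctness of the returned sets\<close>

text \<open>Instance of \<open>is_arg_d_min_extension\<close>: restriction cannot raise the
  objective of \<open>\<omega>\<close>, since it only drops pairs, and the negated test says that
  each member of \<open>Sol\<close> extends at no extra cost.\<close>

lemma solve_extension_step:
  fixes \<phi> :: "('a, 'k::finite, 'w::{linorder,order_bot}) family"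
  assumes fin: "finite T" and prob: "second_order_problem T \<phi>" and t: "t \<in> T"
    and S: "S = T - {t}" "S \<noteq> {}" and \<omega>: "\<omega> = omega S t \<phi>"
    and Sol: "is_arg_d_min d (objective S \<omega>) (labellings S) Sol"
    and test: "\<not> (\<exists>x\<in>Sol. objective S \<omega> x < (MIN k. MAX i\<in>S. \<omega> t i k (x i)))"
    and Sol': "is_arg_d_min d (objective T \<omega>) {x(t := k) | x k. x \<in> Sol} Sol'"
  shows "is_arg_d_min d (objective T \<phi>) (labellings T) Sol'"
proof -
  let ?\<pi> = "\<lambda>z :: 'a \<Rightarrow> 'k. z(t := undefined)"
  have finS: "finite S" using fin S by simp
  have objT: "objective T \<omega> = objective T \<phi>"
    using objective_omega[OF prob fin t S] \<omega> by auto
  have objS: "objective S \<omega> (z(t := k)) = objective S \<omega> z" for z :: "'a \<Rightarrow> 'k" and k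
    by (rule objective_cong) (simp add: S)
  have sub: "Sol \<subseteq> labellings S" using Sol by (auto simp: is_arg_d_min_def split: if_splits)
  have ext: "{x(t := k) | x k. x \<in> Sol} = {z \<in> labellings T. ?\<pi> z \<in> Sol}"
    using extensions_eq[OF t] sub S(1) by simp
  show ?thesis
  proof (rule is_arg_d_min_extension)
    show "finite (labellings T :: ('a \<Rightarrow> 'k) set)" using fin by (rule finite_labellings)
    show "is_arg_d_min d (objective S \<omega>) (?\<pi> ` labellings T) Sol"
      using Sol by (simp add: labellings_remove[OF t] S(1))
    show "is_arg_d_min d (objective T \<phi>) {z \<in> labellings T. ?\<pi> z \<in> Sol} Sol'"
      using Sol' unfolding ext objT .
    show "objective S \<omega> (?\<pi> z) \<le> objective T \<phi> z" for z
      unfolding objS objT[symmetric]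
      using le_objective[OF fin, of _ _ \<omega> z] S by (subst objective_le_iff[OF finS]) auto
    show "\<exists>z\<in>labellings T. ?\<pi> z = x \<and> objective T \<phi> z \<le> objective S \<omega> x" if x: "x \<in> Sol" for x
    proof -
      let ?v = "objective S \<omega> x"
      \<comment> \<open>A label attaining this minimum is the value to assign at \<open>t\<close>:
        it bounds the pairs involving \<open>t\<close>, while pairs inside \<open>S\<close> keep
        their values.\<close>
      have "(MIN k. MAX i\<in>S. \<omega> t i k (x i)) \<le> ?v" using test x by (meson leI)
      then obtain k where k: "\<And>i. i \<in> S \<Longrightarrow> \<omega> t i k (x i) \<le> ?v"
        using finS S(2) by (auto simp: Min_le_iff)
      have kt: "\<omega> i t (x i) k \<le> ?v" if "i \<in> S" for i
        using k[OF that] that S by (auto simp: \<omega> omega_def)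
      have "\<omega> i j ((x(t := k)) i) ((x(t := k)) j) \<le> ?v" if "i \<in> T" "j \<in> T" for i j
        using that k kt le_objective[OF finS, of i j \<omega> x] S by (auto simp: \<omega> omega_def)
      then have "objective T \<phi> (x(t := k)) \<le> ?v"
        unfolding objT[symmetric] using fin t by (subst objective_le_iff) auto
      moreover have "x(t := k) \<in> {z \<in> labellings T. ?\<pi> z \<in> Sol}" using ext x by blast
      moreover have "?\<pi> (x(t := k)) = x"
        using labellings_undefined[of x S t] x sub S(1) by auto
      ultimately show ?thesis by blast
    qed
  qed
qed

lemma card_remove_ge_two:
  assumes "2 < card T" "t \<in> T"
  shows "2 \<le> card (T - {t})"
  using assms by (simp add: card_Diff_singleton)

lemma solve_correct:
  fixes \<phi> :: "('a, 'k::finite, 'w::{linorder,order_bot}) family"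
  assumes "solve d T \<phi> (Solution Sol)" "second_order_problem T \<phi>"
  shows "is_arg_d_min d (objective T \<phi>) (labellings T) Sol"
  using assms
proof (induction T \<phi> "Solution Sol :: ('a, 'k) outcome" arbitrary: Sol rule: solve.induct)
  case (two_objects T a b \<phi> Sol)
  then have "objective T \<phi> = (\<lambda>x. \<phi> a b (x a) (x b))"
    by (auto simp: objective_two_objects)
  then show ?case using two_objects by simp
next
  case (extend T t S \<omega> \<phi> Sol WORK Sol')
  have fin: "finite T" using extend.hyps(1) by (intro card_ge_0_finite) simp
  have "2 \<le> card S" using card_remove_ge_two[OF extend.hyps(1,2)] extend.hyps(3) by simp
  then have ne: "S \<noteq> {}" by auto
  have "second_order_problem S \<omega>"
    unfolding extend.hyps(4)
    by (rule second_order_problem_omega[OF extend.prems]) (simp add: extend.hyps(3))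
  then have "is_arg_d_min d (objective S \<omega>) (labellings S) Sol" by (rule extend.hyps(6))
  then show ?case
    using extend.hyps(7,9) unfolding extend.hyps(8)
    by (rule solve_extension_step[OF fin extend.prems extend.hyps(2,3) ne extend.hyps(4)])
qed

section \<open>Inheritance of majority polymorphisms\<close>

lemma polymorphism_le:
  fixes \<phi> :: "('a, 'k, 'w::linorder) family"
  assumes "polymorphism T \<phi> p" "i \<in> T" "j \<in> T" "i \<noteq> j"
    and "\<phi> i j a1 b1 \<le> v" "\<phi> i j a2 b2 \<le> v" "\<phi> i j a3 b3 \<le> v"
  shows "\<phi> i j (p i a1 a2 a3) (p j b1 b2 b3) \<le> v"
proof -
  have "\<phi> i j (p i a1 a2 a3) (p j b1 b2 b3)
      \<le> max (\<phi> i j a1 b1) (max (\<phi> i j a2 b2) (\<phi> i j a3 b3))"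
    using assms(1-4) unfolding polymorphism_def by blast
  also have "\<dots> \<le> v" using assms(5-7) by simp
  finally show ?thesis .
qed

text \<open>For each object \<open>i\<close>, \<open>p i\<close> merges the three witnesses of the
  inner minima into a witness for the merged label.\<close>

lemma qfun_polymorphism_le:
  fixes \<phi> :: "('a, 'k::finite, 'w::linorder) family"
  assumes pol: "polymorphism T \<phi> p" and t: "t \<in> T" and S: "S \<subseteq> T - {t}" "finite S" "S \<noteq> {}"
    and "qfun S t \<phi> k1 \<le> v" "qfun S t \<phi> k2 \<le> v" "qfun S t \<phi> k3 \<le> v"
  shows "qfun S t \<phi> (p t k1 k2 k3) \<le> v"
proof -
  have "\<exists>x. \<phi> t i (p t k1 k2 k3) x \<le> v" if i: "i \<in> S" for i
  proof -
    obtain x1 x2 x3 where "\<phi> t i k1 x1 \<le> v" "\<phi> t i k2 x2 \<le> v" "\<phi> t i k3 x3 \<le> v"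
      using assms(6-8) i by (simp add: qfun_le_iff[OF S(2,3)]) blast
    moreover have "i \<in> T" "t \<noteq> i" using S i by auto
    ultimately show ?thesis using polymorphism_le[OF pol t] by blast
  qed
  then show ?thesis by (simp add: qfun_le_iff[OF S(2,3)])
qed

text \<open>The same operators work for the reduced problem: if \<open>k1\<close>,
  \<open>k2\<close>, \<open>k3\<close> witness the three \<open>psi\<close> bounds, then
  \<open>p t k1 k2 k3\<close> witnesses the bound for the merged labels.\<close>

lemma polymorphism_omega:
  fixes \<phi> :: "('a, 'k::finite, 'w::{linorder,order_bot}) family"
  assumes pol: "polymorphism T \<phi> p" and t: "t \<in> T" and S: "S \<subseteq> T - {t}" "finite S"
  shows "polymorphism S (omega S t \<phi>) p"
  unfolding polymorphism_def
proof (intro ballI impI allI)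
  fix i j a1 a2 a3 b1 b2 b3
  assume i: "i \<in> S" and j: "j \<in> S" and "i \<noteq> j"
  have ij: "i \<in> T" "j \<in> T" "t \<noteq> i" "t \<noteq> j" "S \<noteq> {}" using S i j by auto
  have om: "omega S t \<phi> i j x y = max (\<phi> i j x y) (psi S t \<phi> i j x y)" for x y
    using \<open>i \<noteq> j\<close> ij by (simp add: omega_def)
  define v where "v = max (omega S t \<phi> i j a1 b1)
    (max (omega S t \<phi> i j a2 b2) (omega S t \<phi> i j a3 b3))"
  have le: "\<phi> i j a1 b1 \<le> v" "\<phi> i j a2 b2 \<le> v" "\<phi> i j a3 b3 \<le> v"
    and psi: "psi S t \<phi> i j a1 b1 \<le> v" "psi S t \<phi> i j a2 b2 \<le> v" "psi S t \<phi> i j a3 b3 \<le> v"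
    by (auto simp: v_def om le_max_iff_disj)
  obtain k1 where k1: "\<phi> t i k1 a1 \<le> v" "\<phi> t j k1 b1 \<le> v" "qfun S t \<phi> k1 \<le> v"
    using psi(1) unfolding psi_le_iff by blast
  obtain k2 where k2: "\<phi> t i k2 a2 \<le> v" "\<phi> t j k2 b2 \<le> v" "qfun S t \<phi> k2 \<le> v"
    using psi(2) unfolding psi_le_iff by blast
  obtain k3 where k3: "\<phi> t i k3 a3 \<le> v" "\<phi> t j k3 b3 \<le> v" "qfun S t \<phi> k3 \<le> v"
    using psi(3) unfolding psi_le_iff by blast
  have "\<phi> t i (p t k1 k2 k3) (p i a1 a2 a3) \<le> v"
    using k1 k2 k3 by (intro polymorphism_le[OF pol t ij(1,3)])
  moreover have "\<phi> t j (p t k1 k2 k3) (p j b1 b2 b3) \<le> v"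
    using k1 k2 k3 by (intro polymorphism_le[OF pol t ij(2,4)])
  moreover have "qfun S t \<phi> (p t k1 k2 k3) \<le> v"
    using k1 k2 k3 by (intro qfun_polymorphism_le[OF pol t S ij(5)])
  ultimately have "psi S t \<phi> i j (p i a1 a2 a3) (p j b1 b2 b3) \<le> v"
    unfolding psi_le_iff by blast
  moreover have "\<phi> i j (p i a1 a2 a3) (p j b1 b2 b3) \<le> v"
    using le by (intro polymorphism_le[OF pol ij(1,2) \<open>i \<noteq> j\<close>])
  ultimately show "omega S t \<phi> i j (p i a1 a2 a3) (p j b1 b2 b3)
      \<le> max (omega S t \<phi> i j a1 b1) (max (omega S t \<phi> i j a2 b2) (omega S t \<phi> i j a3 b3))"
    unfolding v_def[symmetric] unfolding om by simp
qed

lemma has_majority_polymorphism_omega: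
  fixes \<phi> :: "('a, 'k::finite, 'w::{linorder,order_bot}) family"
  assumes "has_majority_polymorphism T \<phi>" "t \<in> T" "S \<subseteq> T - {t}" "finite S"
  shows "has_majority_polymorphism S (omega S t \<phi>)"
proof -
  obtain p where p: "majority_operator T p" "polymorphism T \<phi> p"
    using assms(1) by (auto simp: has_majority_polymorphism_def)
  have "majority_operator S p" using p(1) assms(3) by (auto simp: majority_operator_def)
  then show ?thesis
    using polymorphism_omega[OF p(2) assms(2-4)] by (auto simp: has_majority_polymorphism_def)
qed

section \<open>Helly-type extension and the discard test\<close>

text \<open>Induction on the size of \<open>I\<close>. Pairs are handled by \<open>psi\<close>; a
  larger set is handled by merging the labels obtained after dropping each of three distinct
  objects. The bound on \<open>qfun\<close> is carried along because the merge needs it at the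
  dropped objects.\<close>

lemma majority_common_label:
  fixes \<phi> :: "('a, 'k::finite, 'w::linorder) family"
  assumes maj: "majority_operator T p" and pol: "polymorphism T \<phi> p"
    and t: "t \<in> T" and S: "S \<subseteq> T - {t}" "finite S"
    and pairs: "\<And>i j. i \<in> S \<Longrightarrow> j \<in> S \<Longrightarrow> i \<noteq> j \<Longrightarrow> psi S t \<phi> i j (x i) (x j) \<le> v"
    and I: "I \<subseteq> S" "2 \<le> card I"
  shows "\<exists>k. qfun S t \<phi> k \<le> v \<and> (\<forall>i\<in>I. \<phi> t i k (x i) \<le> v)"
  using I
proof (induction "card I" arbitrary: I rule: less_induct)
  case less
  have finI: "finite I" using less.prems S(2) finite_subset by blast
  show ?case
  proof (cases "card I = 2")
    case True
    then obtain i j where "I = {i, j}" "i \<noteq> j" by (auto simp: card_2_iff)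
    then show ?thesis using pairs[of i j] less.prems by (auto simp: psi_le_iff)
  next
    case False
    then have three: "3 \<le> card I" using less.prems by simp
    then obtain J where "J \<subseteq> I" "card J = 3" by (rule obtain_subset_with_card_n)
    then obtain a b c where abc: "a \<in> I" "b \<in> I" "c \<in> I" "a \<noteq> b" "b \<noteq> c" "a \<noteq> c"
      by (auto simp: card_3_iff)
    have "\<exists>k. qfun S t \<phi> k \<le> v \<and> (\<forall>i\<in>I - {e}. \<phi> t i k (x i) \<le> v)" if "e \<in> I" for e
      using less.hyps[of "I - {e}"] less.prems that three finI by fastforce
    then obtain ka kb kc where
      q: "qfun S t \<phi> ka \<le> v" "qfun S t \<phi> kb \<le> v" "qfun S t \<phi> kc \<le> v" and
      k: "\<And>i. i \<in> I - {a} \<Longrightarrow> \<phi> t i ka (x i) \<le> v"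
         "\<And>i. i \<in> I - {b} \<Longrightarrow> \<phi> t i kb (x i) \<le> v"
         "\<And>i. i \<in> I - {c} \<Longrightarrow> \<phi> t i kc (x i) \<le> v"
      using abc(1-3) by metis
    have ne: "S \<noteq> {}" using abc less.prems by auto
    have "\<phi> t i (p t ka kb kc) (x i) \<le> v" if i: "i \<in> I" for i
    proof -
      have iT: "i \<in> T" "t \<noteq> i" using i less.prems S by auto
      have m: "p i y (x i) (x i) = x i" "p i (x i) y (x i) = x i" "p i (x i) (x i) y = x i" for y
        using maj iT by (auto simp: majority_operator_def)
      \<comment> \<open>A label for \<open>t\<close> obtained without \<open>i\<close> may clash
        with \<open>x i\<close>, but its \<open>qfun\<close> bound still provides some label at
        \<open>i\<close> compatible with it.\<close>
      have "\<exists>y. \<phi> t i k' y \<le> v" if "qfun S t \<phi> k' \<le> v" for k'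
        using that i less.prems by (auto simp: qfun_le_iff[OF S(2) ne])
      then obtain ya yb yc where y: "\<phi> t i ka ya \<le> v" "\<phi> t i kb yb \<le> v" "\<phi> t i kc yc \<le> v"
        using q by meson
      \<comment> \<open>At most one of \<open>ka\<close>, \<open>kb\<close>, \<open>kc\<close> was
        obtained without \<open>i\<close>. The compatible label \<open>y\<close> fills one slot,
        \<open>x i\<close> the other two, and majority returns \<open>x i\<close>. The last case
        includes \<open>i = c\<close>.\<close>
      consider "i = a" | "i = b" | "i \<noteq> a" "i \<noteq> b" by blast
      then show ?thesis
      proof cases
        case 1
        then have "\<phi> t i kb (x i) \<le> v" "\<phi> t i kc (x i) \<le> v" using k(2,3) i abc by auto
        from polymorphism_le[OF pol t iT y(1) this] show ?thesis unfolding m .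
      next
        case 2
        then have "\<phi> t i ka (x i) \<le> v" "\<phi> t i kc (x i) \<le> v" using k(1,3) i abc by auto
        from polymorphism_le[OF pol t iT this(1) y(2) this(2)] show ?thesis unfolding m .
      next
        case 3
        then have "\<phi> t i ka (x i) \<le> v" "\<phi> t i kb (x i) \<le> v" using k(1,2) i by auto
        from polymorphism_le[OF pol t iT this y(3)] show ?thesis unfolding m .
      qed
    qed
    moreover have "qfun S t \<phi> (p t ka kb kc) \<le> v"
      using q by (intro qfun_polymorphism_le[OF pol t S ne])
    ultimately show ?thesis by blast
  qed
qed

text \<open>On distinct objects of \<open>S\<close>, \<open>omega\<close> dominates
  \<open>psi\<close>, so the objective bounds all pairs and \<open>majority_common_label\<close>
  applies with \<open>I = S\<close>. The labelling \<open>x\<close> is arbitrary, so the choice of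
  \<open>Sol\<close> is irrelevant.\<close>

lemma majority_passes_test:
  fixes \<phi> :: "('a, 'k::finite, 'w::{linorder,order_bot}) family"
  assumes poly: "has_majority_polymorphism T \<phi>" and t: "t \<in> T"
    and S: "S \<subseteq> T - {t}" "finite S" "2 \<le> card S"
  shows "(MIN k. MAX i\<in>S. omega S t \<phi> t i k (x i)) \<le> objective S (omega S t \<phi>) x"
proof -
  let ?v = "objective S (omega S t \<phi>) x"
  obtain p where p: "majority_operator T p" "polymorphism T \<phi> p"
    using poly by (auto simp: has_majority_polymorphism_def)
  have "psi S t \<phi> i j (x i) (x j) \<le> ?v" if "i \<in> S" "j \<in> S" "i \<noteq> j" for i j
  proof -
    have "psi S t \<phi> i j (x i) (x j) \<le> omega S t \<phi> i j (x i) (x j)"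
      using that S(1) by (auto simp: omega_def)
    also have "\<dots> \<le> ?v" using le_objective[OF S(2) that(1,2)] .
    finally show ?thesis .
  qed
  then obtain k where "\<forall>i\<in>S. \<phi> t i k (x i) \<le> ?v"
    using majority_common_label[OF p t S(1,2) _ subset_refl S(3)] by blast
  then have "\<forall>i\<in>S. omega S t \<phi> t i k (x i) \<le> ?v" by (auto simp: omega_def)
  moreover have "S \<noteq> {}" using S(3) by auto
  ultimately show ?thesis using S(2) by (auto simp: Min_le_iff)
qed

text \<open>Induction along the run: the polymorphism passes to the recursive call, which rules out
  an inherited discard, and the strict inequality of the test fails at every level.\<close>

lemma majority_not_discard:
  fixes \<phi> :: "('a, 'k::finite, 'w::{linorder,order_bot}) family"
  assumes "solve d T \<phi> r" "has_majority_polymorphism T \<phi>"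
  shows "r \<noteq> Discard"
  using assms
proof (induction rule: solve.induct)
  case (discard_in_recursion T t S \<omega> \<phi>)
  have "finite S"
    using discard_in_recursion.hyps(1,3) card_ge_0_finite[of T] by simp
  then have "has_majority_polymorphism S \<omega>"
    unfolding discard_in_recursion.hyps(4)
    by (intro has_majority_polymorphism_omega[OF discard_in_recursion.prems])
      (use discard_in_recursion.hyps in auto)
  then show ?case using discard_in_recursion.IH by simp
next
  case (discard_by_test T t S \<omega> \<phi> Sol)
  have "finite S" using discard_by_test.hyps(1,3) card_ge_0_finite[of T] by simp
  moreover have "2 \<le> card S"
    using card_remove_ge_two[OF discard_by_test.hyps(1,2)] discard_by_test.hyps(3) by simp
  ultimately have "(MIN k. MAX i\<in>S. \<omega> t i k (x i)) \<le> objective S \<omega> x" for x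
    unfolding discard_by_test.hyps(4)
    by (intro majority_passes_test[OF discard_by_test.prems])
      (use discard_by_test.hyps in auto)
  then show ?case using discard_by_test.hyps(6) by (meson leD)
qed simp_all

theorem theorem2:
  fixes d :: nat
    and T :: "'a set"
    and \<phi> :: "'a \<Rightarrow> 'a \<Rightarrow> 'k::finite \<Rightarrow> 'k \<Rightarrow> 'w::{linorder,order_bot}"
  assumes "1 \<le> d"
    and "finite T"
    and "2 \<le> card T"
    and "second_order_problem T \<phi>"
  shows "(\<forall>Sol'. solve d T \<phi> (Solution Sol') \<longrightarrow>
            is_arg_d_min d (objective T \<phi>) (labellings T) Sol')
       \<and> (has_majority_polymorphism T \<phi> \<longrightarrow>
            (\<forall>r. solve d T \<phi> r \<longrightarrow>
               (\<exists>Sol'. r = Solution Sol' \<and>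
                  is_arg_d_min d (objective T \<phi>) (labellings T) Sol')))"
proof (intro conjI allI impI)
  show correct: "is_arg_d_min d (objective T \<phi>) (labellings T) Sol'"
    if "solve d T \<phi> (Solution Sol')" for Sol'
    using solve_correct[OF that assms(4)] .
  show "\<exists>Sol'. r = Solution Sol' \<and> is_arg_d_min d (objective T \<phi>) (labellings T) Sol'"
    if "has_majority_polymorphism T \<phi>" "solve d T \<phi> r" for r
    using majority_not_discard[OF that(2,1)] correct that(2) by (cases r) auto
qed

end
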